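(* Let $X$ be a symmetric real random variable, not almost surely zero, with finite moments of all orders, and let $r_k=\frac{k!\,\mathbb{E}[X^{2k}]}{(2k)!}$ for $k\geq 0$. Let $p\geq 2$ be an even integer. For $n\geq 1$, $(a_1,\ldots,a_n)\in\mathbb{R}^n$ and iid copies $X_1,\ldots,X_n$ of $X$, let $S=\sum_{k=1}^n a_kX_k$. (1) If $(r_k)_{k\ge 0}$ is log-concave, then for all $n\geq 1$ and all $(a_1,\ldots,a_n)\in\mathbb{R}^n$, $$\Big(\frac{\|X\|_p}{\|X\|_2}\Big)\|S\|_2\leq \|S\|_p\leq \gamma_p\|S\|_2.$$ (2) If $(r_k)_{k\ge 0}$ is log-convex, then for all $n\geq 1$ and all $(a_1,\ldots,a_n)\in\mathbb{R}^n$, $$\gamma_p\|S\|_2\leq \|S\|_p\leq \Big(\frac{\|X\|_p}{\|X\|_2}\Big)\|S\|_2.$$ Moreover, the constants are optimal: in each of (1) and (2), the constant in the lower bound cannot be replaced by a larger one, and the constant in the upper bound cannot be replaced by a smaller one, such that the inequality still holds for all $n\geq 1$ and all $(a_1,\ldots,a_n)\in\mathbb{R}^n$.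
   Context: $\|Y\|_p=(\mathbb{E}|Y|^p)^{1/p}$ denotes the $L_p$ norm of a random variable $Y$, and $\gamma_p$ denotes the $L_p$ norm of a standard Gaussian random variable. A random variable $X$ is symmetric if $X$ and $-X$ have the same distribution. A sequence of positive numbers $(r_k)_{k\geq 0}$ is log-concave if $r_k^2\geq r_{k-1}r_{k+1}$ for all $k\geq 1$, and log-convex if $r_k^2\leq r_{k-1}r_{k+1}$ for all $k\geq 1$. *)

theory Defs
  imports "HOL-Probability.Probability"
begin

text \<open>Meant for \<open>p > 0\<close> and \<open>\<bar>Y\<bar>\<^sup>p\<close> integrable: the Bochner integral of a non-integrable
  function is \<open>0\<close>, not \<open>\<infinity>\<close>.\<close>
definition Lp_norm :: "'a measure \<Rightarrow> real \<Rightarrow> ('a \<Rightarrow> real) \<Rightarrow> real" where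
  "Lp_norm M p Y = (\<integral>\<omega>. \<bar>Y \<omega>\<bar> powr p \<partial>M) powr (1 / p)"

definition gaussian_norm :: "real \<Rightarrow> real" where
  "gaussian_norm p = Lp_norm (density lborel std_normal_density) p (\<lambda>x. x)"

definition symmetric_rv :: "'a measure \<Rightarrow> ('a \<Rightarrow> real) \<Rightarrow> bool" where
  "symmetric_rv M X \<longleftrightarrow> distr M borel X = distr M borel (\<lambda>\<omega>. - X \<omega>)"

definition log_concave_seq :: "(nat \<Rightarrow> real) \<Rightarrow> bool" where
  "log_concave_seq r \<longleftrightarrow> (\<forall>k. 0 < r k) \<and> (\<forall>k\<ge>1. (r k)\<^sup>2 \<ge> r (k - 1) * r (k + 1))"

definition log_convex_seq :: "(nat \<Rightarrow> real) \<Rightarrow> bool" where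
  "log_convex_seq r \<longleftrightarrow> (\<forall>k. 0 < r k) \<and> (\<forall>k\<ge>1. (r k)\<^sup>2 \<le> r (k - 1) * r (k + 1))"

definition moment_ratio :: "'a measure \<Rightarrow> ('a \<Rightarrow> real) \<Rightarrow> nat \<Rightarrow> real" where
  "moment_ratio M X k = fact k * (\<integral>\<omega>. X \<omega> ^ (2 * k) \<partial>M) / fact (2 * k)"

definition iid_copies ::
    "'a measure \<Rightarrow> ('a \<Rightarrow> real) \<Rightarrow> 'b measure \<Rightarrow> nat \<Rightarrow> (nat \<Rightarrow> 'b \<Rightarrow> real) \<Rightarrow> bool" where
  "iid_copies M X N n Y \<longleftrightarrow>
     prob_space N \<and>
     prob_space.indep_vars N (\<lambda>_. borel) Y {1..n} \<and>
     (\<forall>k\<in>{1..n}. distr N borel (Y k) = distr M borel X)"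

definition weighted_sum :: "nat \<Rightarrow> (nat \<Rightarrow> real) \<Rightarrow> (nat \<Rightarrow> 'b \<Rightarrow> real) \<Rightarrow> 'b \<Rightarrow> real" where
  "weighted_sum n a Y = (\<lambda>\<omega>. \<Sum>k=1..n. a k * Y k \<omega>)"

text \<open>The moment comparisons with constant \<open>C\<close>, for all numbers \<open>n\<close> of summands, all
  coefficients and all iid copies of \<open>X\<close>. The type argument is the type of the sample points on
  which the copies are defined; it is explicit because it does not occur in the other arguments.
  The type \<open>nat \<Rightarrow> real\<close> supports the canonical copies, the coordinates on a product of \<open>n\<close>
  copies of the law of \<open>X\<close>, so on it the comparisons are never vacuous.\<close>
definition lower_comparison ::
    "'b itself \<Rightarrow> 'a measure \<Rightarrow> ('a \<Rightarrow> real) \<Rightarrow> real \<Rightarrow> real \<Rightarrow> bool" where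
  "lower_comparison T M X p C \<longleftrightarrow>
     (\<forall>n\<ge>1. \<forall>a. \<forall>(N :: 'b measure) Y. iid_copies M X N n Y \<longrightarrow>
        C * Lp_norm N 2 (weighted_sum n a Y) \<le> Lp_norm N p (weighted_sum n a Y))"

definition upper_comparison ::
    "'b itself \<Rightarrow> 'a measure \<Rightarrow> ('a \<Rightarrow> real) \<Rightarrow> real \<Rightarrow> real \<Rightarrow> bool" where
  "upper_comparison T M X p C \<longleftrightarrow>
     (\<forall>n\<ge>1. \<forall>a. \<forall>(N :: 'b measure) Y. iid_copies M X N n Y \<longrightarrow>
        Lp_norm N p (weighted_sum n a Y) \<le> C * Lp_norm N 2 (weighted_sum n a Y))"

end

theory Submission
  imports Defs
begin

text \<open>The normalisation \<open>r\<^sub>k = k! E X\<^sup>2\<^sup>k / (2k)!\<close> is the one for which independent symmetric summands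
  combine by a binomial convolution: expanding \<open>E (S + Y)\<^sup>2\<^sup>m\<close> and dropping the odd moments
  of \<open>Y\<close>, which vanish, gives
  \<open>s\<^sub>m(S + Y) = \<Sum>k\<le>m. (m choose k) s\<^sub>k(S) s\<^sub>m\<^sub>-\<^sub>k(Y)\<close>, where \<open>s\<^sub>k\<close> denotes the moment ratio
  (\<open>moment_ratio_add\<close>). A multiple \<open>a X\<close> has the moment ratios \<open>a\<^sup>2\<^sup>k r\<^sub>k\<close>, and for a centred
  Gaussian of variance \<open>v\<close> they form the geometric sequence \<open>(v/2)\<^sup>k\<close>.

  Convolution with nonnegative sequences is monotone. Hence, if \<open>G\<^sub>t\<close> is a family of sequences,
  indexed by \<open>t \<ge> 0\<close>, that dominates \<open>t\<^sup>k r\<^sub>k\<close> for every \<open>t = a\<^sub>i\<^sup>2\<close> and satisfies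
  \<open>G\<^sub>s * G\<^sub>t \<le> G\<^sub>s\<^sub>+\<^sub>t\<close>, then it dominates the moment ratios of \<open>S = \<Sum> a\<^sub>i X\<^sub>i\<close> at
  \<open>t = \<Sum> a\<^sub>i\<^sup>2\<close>, and there is a dual statement for lower bounds
  (\<open>moment_ratio_weighted_sum_le\<close>, \<open>moment_ratio_weighted_sum_ge\<close>). Every estimate of the proof
  is an instance for one of three families.

  If \<open>r\<close> is log-concave, then \<open>r\<^sub>0 = 1\<close> makes it submultiplicative:
  \<open>r\<^sub>i\<^sub>+\<^sub>j \<le> r\<^sub>i r\<^sub>j\<close>, and in particular \<open>r\<^sub>k \<le> r\<^sub>1\<^sup>k\<close>. The family \<open>t\<^sup>k r\<^sub>k\<close> then gives
  \<open>r\<^sub>m (\<Sum> a\<^sub>i\<^sup>2)\<^sup>m \<le> s\<^sub>m(S)\<close>, the family \<open>(r\<^sub>1 t)\<^sup>k\<close> gives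
  \<open>s\<^sub>m(S) \<le> (r\<^sub>1 \<Sum> a\<^sub>i\<^sup>2)\<^sup>m\<close>, and since \<open>E S\<^sup>2 = 2 r\<^sub>1 \<Sum> a\<^sub>i\<^sup>2\<close>, these are the two comparisons
  for \<open>p = 2m\<close>. In the log-convex case all inequalities are reversed.

  The constant \<open>\<parallel>X\<parallel>\<^sub>p / \<parallel>X\<parallel>\<^sub>2\<close> is attained by a single summand. The Gaussian constant is the
  limit of \<open>\<parallel>S\<^sub>n\<parallel>\<^sub>p / \<parallel>S\<^sub>n\<parallel>\<^sub>2\<close> for \<open>S\<^sub>n = X\<^sub>1 + \<dots> + X\<^sub>n\<close>
  (\<open>canonical_norm_quotient_tendsto\<close>). This convergence holds for every symmetric \<open>X\<close> with
  finite moments that is not almost surely zero, and follows from the third family, the stepped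
  factorials \<open>\<Prod>i<k. (t r\<^sub>1 + i c)\<close>. By the Chu-Vandermonde identity they are closed under
  convolution, at \<open>t = n\<close> they are asymptotic to \<open>(n r\<^sub>1)\<^sup>k\<close>, and at \<open>t = 1\<close> they
  bound \<open>r\<^sub>k\<close> from below for \<open>c = - r\<^sub>1\<close>, and from above for all \<open>k \<le> m\<close> if \<open>c\<close> is large.\<close>

section \<open>Binomial convolution\<close>

definition binom_conv :: "(nat \<Rightarrow> real) \<Rightarrow> (nat \<Rightarrow> real) \<Rightarrow> nat \<Rightarrow> real" where
  "binom_conv f g m = (\<Sum>k\<le>m. real (m choose k) * f k * g (m - k))"

lemma binom_conv_mono:
  assumes "\<And>k. k \<le> m \<Longrightarrow> 0 \<le> f k" "\<And>k. k \<le> m \<Longrightarrow> f k \<le> f' k"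
    and "\<And>k. k \<le> m \<Longrightarrow> 0 \<le> g k" "\<And>k. k \<le> m \<Longrightarrow> g k \<le> g' k"
  shows "binom_conv f g m \<le> binom_conv f' g' m"
  unfolding binom_conv_def mult.assoc
proof (intro sum_mono mult_left_mono mult_mono)
  fix k assume k: "k \<in> {..m}"
  show "0 \<le> f' k"
    using assms(1,2)[of k] k by simp
qed (use assms in auto)

lemma binom_conv_power: "binom_conv (\<lambda>k. x ^ k) (\<lambda>k. y ^ k) m = (x + y) ^ m"
  by (simp add: binom_conv_def binomial_ring)


text \<open>Two sequences of sequences, one growing at most and the other at least as fast as an iterated
  convolution, stay ordered. All inequalities are required only up to index \<open>m\<close>, because
  convolution at an index uses no larger index; this matters for the stepped factorials, which bound
  only finitely many terms of \<open>r\<close> at a time.\<close>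

lemma binom_conv_comparison:
  fixes f g \<phi> \<psi> :: "nat \<Rightarrow> nat \<Rightarrow> real"
  assumes f0: "\<And>n k. n < L \<Longrightarrow> k \<le> m \<Longrightarrow> 0 \<le> f n k"
    and \<phi>0: "\<And>n k. n < L \<Longrightarrow> k \<le> m \<Longrightarrow> 0 \<le> \<phi> n k"
    and start: "\<And>k. k \<le> m \<Longrightarrow> f 0 k \<le> g 0 k"
    and f: "\<And>n k. n < L \<Longrightarrow> k \<le> m \<Longrightarrow> f (Suc n) k \<le> binom_conv (f n) (\<phi> n) k"
    and le: "\<And>n k. n < L \<Longrightarrow> k \<le> m \<Longrightarrow> \<phi> n k \<le> \<psi> n k"
    and g: "\<And>n k. n < L \<Longrightarrow> k \<le> m \<Longrightarrow> binom_conv (g n) (\<psi> n) k \<le> g (Suc n) k"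
    and "n \<le> L" "k \<le> m"
  shows "f n k \<le> g n k"
  using assms(7,8)
proof (induction n arbitrary: k)
  case 0
  then show ?case using start by simp
next
  case (Suc n)
  then have n: "n < L" by simp
  have "f (Suc n) k \<le> binom_conv (f n) (\<phi> n) k"
    using f n Suc.prems by simp
  also have "\<dots> \<le> binom_conv (g n) (\<psi> n) k"
    using Suc n f0 \<phi>0 le by (intro binom_conv_mono) auto
  also have "\<dots> \<le> g (Suc n) k"
    using g n Suc.prems by simp
  finally show ?case .
qed

text \<open>Powers, rescaled rising factorials and rescaled falling factorials are the cases
  \<open>c = 0\<close>, \<open>c > 0\<close> and \<open>c < 0\<close>.\<close>

definition stepped_factorial :: "real \<Rightarrow> real \<Rightarrow> nat \<Rightarrow> real" where
  "stepped_factorial c x m = (\<Prod>i<m. x + real i * c)"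

lemma stepped_factorial_0_step [simp]: "stepped_factorial 0 x m = x ^ m"
  by (simp add: stepped_factorial_def)

lemma stepped_factorial_0_left: "stepped_factorial c 0 m = 0 ^ m"
proof (cases "m = 0")
  case False
  then have "stepped_factorial c 0 m = 0"
    unfolding stepped_factorial_def by (intro prod_zero bexI[of _ 0]) auto
  then show ?thesis
    using False by simp
qed (simp add: stepped_factorial_def)

lemma stepped_factorial_eq_pochhammer:
  assumes "c \<noteq> 0"
  shows "stepped_factorial c x m = c ^ m * pochhammer (x / c) m"
proof (induction m)
  case 0
  then show ?case by (simp add: stepped_factorial_def)
next
  case (Suc m)
  then show ?case
    using assms by (simp add: stepped_factorial_def pochhammer_Suc field_simps)
qed

text \<open>For \<open>c = 0\<close> this is the binomial theorem, for \<open>c \<noteq> 0\<close> the Chu-Vandermonde identity for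
  rising factorials at the arguments \<open>x / c\<close> and \<open>y / c\<close>.\<close>

lemma stepped_factorial_add:
  "stepped_factorial c (x + y) m = binom_conv (stepped_factorial c x) (stepped_factorial c y) m"
proof (cases "c = 0")
  case True
  then show ?thesis
    using binom_conv_power[of x y m] by (simp add: binom_conv_def)
next
  case False
  have "stepped_factorial c (x + y) m
      = c ^ m * (\<Sum>k\<le>m. real (m choose k) * pochhammer (x / c) k * pochhammer (y / c) (m - k))"
    by (simp add: stepped_factorial_eq_pochhammer[OF False] add_divide_distrib pochhammer_binomial_sum)
  also have "\<dots> = binom_conv (stepped_factorial c x) (stepped_factorial c y) m"
    unfolding binom_conv_def sum_distrib_left
  proof (intro sum.cong refl)
    fix k assume "k \<in> {..m}"
    then have "c ^ m = c ^ k * c ^ (m - k)"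
      by (simp add: power_add[symmetric])
    then show "c ^ m * (real (m choose k) * pochhammer (x / c) k * pochhammer (y / c) (m - k))
        = real (m choose k) * stepped_factorial c x k * stepped_factorial c y (m - k)"
      by (simp add: stepped_factorial_eq_pochhammer[OF False])
  qed
  finally show ?thesis .
qed

lemma stepped_factorial_nonneg:
  assumes "0 \<le> x" "0 \<le> c"
  shows "0 \<le> stepped_factorial c x m"
  using assms by (simp add: stepped_factorial_def prod_nonneg)

text \<open>A falling factorial of an arbitrary real number may be negative. At a multiple of the step it
  reaches the factor zero before the factors change sign.\<close>

lemma falling_stepped_factorial_nonneg:
  assumes "0 \<le> x"
  shows "0 \<le> stepped_factorial (- x) (real n * x) m"
proof (cases "m \<le> n")
  case True
  then show ?thesis
    using assms by (auto simp: stepped_factorial_def intro!: prod_nonneg mult_right_mono)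
next
  case False
  then have "stepped_factorial (- x) (real n * x) m = 0"
    unfolding stepped_factorial_def by (intro prod_zero bexI[of _ n]) auto
  then show ?thesis
    by simp
qed

lemma stepped_factorial_asymp:
  "(\<lambda>n. stepped_factorial c (real n * x) m / real n ^ m) \<longlonglongrightarrow> x ^ m"
proof -
  have "(\<lambda>n. \<Prod>i<m. x + real i * c / real n) \<longlonglongrightarrow> (\<Prod>i<m. x + 0)"
    by (intro tendsto_prod tendsto_add tendsto_const lim_const_over_n)
  moreover have "\<forall>\<^sub>F n in sequentially.
      (\<Prod>i<m. x + real i * c / real n) = stepped_factorial c (real n * x) m / real n ^ m"
    using eventually_gt_at_top[of 0]
  proof eventually_elim
    case (elim n)
    have "stepped_factorial c (real n * x) m / real n ^ m = (\<Prod>i<m. (real n * x + real i * c) / real n)"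
      by (simp add: stepped_factorial_def prod_dividef)
    also have "\<dots> = (\<Prod>i<m. x + real i * c / real n)"
      using elim by (intro prod.cong) (auto simp: field_simps)
    finally show ?case by simp
  qed
  ultimately show ?thesis
    by (simp add: tendsto_cong)
qed

text \<open>The step \<open>- r 1\<close> makes the second factor zero, so the lower sequence is
  \<open>1, r 1, 0, 0, \<dots>\<close>. Conversely, from index 2 on, a stepped factorial with \<open>c \<ge> 0\<close> is at
  least \<open>r 1 ^ (k - 1) * c\<close>, which is at least \<open>r k\<close> as soon as \<open>c\<close> is large.\<close>

lemma sequence_between_stepped_factorials:
  fixes r :: "nat \<Rightarrow> real"
  assumes "r 0 = 1" "0 < r 1" "\<And>k. 0 \<le> r k"
  obtains c where "0 \<le> c"
    "\<And>k. k \<le> m \<Longrightarrow> stepped_factorial (- r 1) (r 1) k \<le> r k"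
    "\<And>k. k \<le> m \<Longrightarrow> r k \<le> stepped_factorial c (r 1) k"
proof
  \<comment> \<open>The sum is a convenient upper bound for all quotients \<open>r k / r 1 ^ (k - 1)\<close> at once.\<close>
  define c where "c = (\<Sum>k\<le>m. r k / r 1 ^ (k - 1))"
  show c0: "0 \<le> c"
    using assms by (auto simp: c_def intro!: sum_nonneg divide_nonneg_nonneg)
  fix k assume "k \<le> m"
  consider "k = 0" | "k = 1" | j where "k = Suc (Suc j)"
    by (metis One_nat_def not0_implies_Suc)
  note cases = this
  show "stepped_factorial (- r 1) (r 1) k \<le> r k"
  proof (cases rule: cases)
    case (3 j)
    then have "stepped_factorial (- r 1) (r 1) k = 0"
      by (auto simp: stepped_factorial_def intro!: bexI[of _ 1])
    then show ?thesis
      using assms by simp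
  qed (use assms in \<open>auto simp: stepped_factorial_def\<close>)
  show "r k \<le> stepped_factorial c (r 1) k"
  proof (cases rule: cases)
    case (3 j)
    have "r k / r 1 ^ (k - 1) \<le> c"
      unfolding c_def using assms \<open>k \<le> m\<close> by (intro member_le_sum) auto
    then have "r k \<le> r 1 ^ (k - 1) * c"
      using assms by (simp add: field_simps)
    also have "\<dots> = r 1 ^ Suc j * c"
      using 3 by simp
    also have "\<dots> \<le> stepped_factorial c (r 1) (Suc j) * (r 1 + real (Suc j) * c)"
    proof (intro mult_mono)
      have "r 1 ^ Suc j = (\<Prod>i<Suc j. r 1)"
        by simp
      also have "\<dots> \<le> stepped_factorial c (r 1) (Suc j)"
        unfolding stepped_factorial_def using assms c0 by (intro prod_mono) auto
      finally show "r 1 ^ Suc j \<le> stepped_factorial c (r 1) (Suc j)" .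
      show "c \<le> r 1 + real (Suc j) * c"
        using assms c0 by (simp add: distrib_right)
    qed (use assms c0 in \<open>auto intro!: stepped_factorial_nonneg\<close>)
    also have "\<dots> = stepped_factorial c (r 1) k"
      using 3 by (simp add: stepped_factorial_def)
    finally show ?thesis .
  qed (use assms in \<open>auto simp: stepped_factorial_def\<close>)
qed

section \<open>Log-concave and log-convex sequences\<close>

text \<open>Log-concavity says that the quotients \<open>r (k + 1) / r k\<close> decrease. Building up \<open>r (i + j)\<close>
  from \<open>r i\<close> and \<open>r j\<close> from \<open>r 0 = 1\<close> takes \<open>j\<close> quotients each, and those used for
  \<open>r (i + j)\<close> are the smaller ones.\<close>

lemma log_concave_submultiplicative:
  assumes r: "log_concave_seq r" and r0: "r 0 = 1"
  shows "r (i + j) \<le> r i * r j"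
proof -
  have pos: "0 < r k" for k
    using r by (simp add: log_concave_seq_def)
  have "antimono (\<lambda>k. r (Suc k) / r k)"
    unfolding decseq_Suc_iff
  proof
    fix k
    have "r k * r (Suc (Suc k)) \<le> (r (Suc k))\<^sup>2"
      using r[unfolded log_concave_seq_def, THEN conjunct2, rule_format, of "Suc k"] by simp
    then show "r (Suc (Suc k)) / r (Suc k) \<le> r (Suc k) / r k"
      using pos by (simp add: divide_simps power2_eq_square mult.commute)
  qed
  then have quot: "r (Suc (i + j)) / r (i + j) \<le> r (Suc j) / r j" for j
    by (auto dest: antimonoD[of _ j "i + j"])
  show ?thesis
  proof (induction j)
    case 0
    then show ?case using r0 by simp
  next
    case (Suc j)
    have "r (i + Suc j) = r (i + j) * (r (Suc (i + j)) / r (i + j))"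
      using pos[of "i + j"] by simp
    also have "\<dots> \<le> (r i * r j) * (r (Suc j) / r j)"
      using Suc.IH quot[of j] pos by (intro mult_mono) (auto intro: less_imp_le)
    also have "\<dots> = r i * r (Suc j)"
      using pos[of j] by simp
    finally show ?case .
  qed
qed

text \<open>The reciprocals of a log-convex sequence are log-concave.\<close>

lemma log_convex_supermultiplicative:
  assumes r: "log_convex_seq r" and r0: "r 0 = 1"
  shows "r i * r j \<le> r (i + j)"
proof -
  have pos: "0 < r k" for k
    using r by (simp add: log_convex_seq_def)
  have "log_concave_seq (\<lambda>k. inverse (r k))"
    unfolding log_concave_seq_def
  proof (intro conjI allI impI)
    fix k :: nat assume "1 \<le> k"
    then have "(r k)\<^sup>2 \<le> r (k - 1) * r (k + 1)"
      using r by (simp add: log_convex_seq_def)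
    then have "inverse (r (k - 1) * r (k + 1)) \<le> inverse ((r k)\<^sup>2)"
      using pos[of k] by (intro le_imp_inverse_le) auto
    then show "inverse (r (k - 1)) * inverse (r (k + 1)) \<le> (inverse (r k))\<^sup>2"
      by (simp add: power_inverse)
  qed (use pos in simp)
  from log_concave_submultiplicative[OF this, of i j] r0
  have "inverse (r (i + j)) \<le> inverse (r i * r j)"
    by simp
  then show ?thesis
    by (rule inverse_le_imp_le) (use pos in simp)
qed

lemma submultiplicative_le_power:
  fixes r :: "nat \<Rightarrow> real"
  assumes "\<And>i j. r (i + j) \<le> r i * r j" "r 0 = 1" "0 \<le> r 1"
  shows "r k \<le> r 1 ^ k"
proof (induction k)
  case (Suc k)
  have "r (Suc k) \<le> r 1 * r k"
    using assms(1)[of 1 k] by simp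
  also have "\<dots> \<le> r 1 * r 1 ^ k"
    using Suc assms by (intro mult_left_mono) auto
  finally show ?case by simp
qed (use assms in simp)

lemma supermultiplicative_ge_power:
  fixes r :: "nat \<Rightarrow> real"
  assumes "\<And>i j. r i * r j \<le> r (i + j)" "r 0 = 1" "0 \<le> r 1"
  shows "r 1 ^ k \<le> r k"
proof (induction k)
  case (Suc k)
  have "r 1 ^ Suc k \<le> r 1 * r k"
    using Suc assms by (simp add: mult_left_mono)
  also have "\<dots> \<le> r (Suc k)"
    using assms(1)[of 1 k] by simp
  finally show ?case .
qed (use assms in simp)

text \<open>The product \<open>r k * r (m - k)\<close> occurring in the convolution is at least \<open>r m\<close>, and with
  \<open>r m\<close> in its place the sum is the binomial expansion of \<open>(s + t) ^ m\<close>.\<close>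

lemma binom_conv_weighted_power_ge:
  assumes "\<And>i j. r (i + j) \<le> r i * r j" "0 \<le> s" "0 \<le> t"
  shows "r m * (s + t) ^ m \<le> binom_conv (\<lambda>k. r k * s ^ k) (\<lambda>k. r k * t ^ k) m"
proof -
  have "r m * (s + t) ^ m = (\<Sum>k\<le>m. real (m choose k) * s ^ k * t ^ (m - k) * r (k + (m - k)))"
    unfolding binomial_ring sum_distrib_left by (intro sum.cong) auto
  also have "\<dots> \<le> (\<Sum>k\<le>m. real (m choose k) * s ^ k * t ^ (m - k) * (r k * r (m - k)))"
    by (intro sum_mono mult_left_mono assms(1)) (simp add: assms)
  also have "\<dots> = binom_conv (\<lambda>k. r k * s ^ k) (\<lambda>k. r k * t ^ k) m"
    by (simp add: binom_conv_def mult_ac)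
  finally show ?thesis .
qed

lemma binom_conv_weighted_power_le:
  assumes "\<And>i j. r i * r j \<le> r (i + j)" "0 \<le> s" "0 \<le> t"
  shows "binom_conv (\<lambda>k. r k * s ^ k) (\<lambda>k. r k * t ^ k) m \<le> r m * (s + t) ^ m"
proof -
  have "binom_conv (\<lambda>k. r k * s ^ k) (\<lambda>k. r k * t ^ k) m
      = (\<Sum>k\<le>m. real (m choose k) * s ^ k * t ^ (m - k) * (r k * r (m - k)))"
    by (simp add: binom_conv_def mult_ac)
  also have "\<dots> \<le> (\<Sum>k\<le>m. real (m choose k) * s ^ k * t ^ (m - k) * r (k + (m - k)))"
    by (intro sum_mono mult_left_mono assms(1)) (simp add: assms)
  also have "\<dots> = r m * (s + t) ^ m"
    unfolding binomial_ring sum_distrib_left by (intro sum.cong) auto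
  finally show ?thesis .
qed

section \<open>Even moments of sums of independent symmetric variables\<close>

lemma sum_even_indices:
  fixes f :: "nat \<Rightarrow> real"
  assumes "\<And>k. odd k \<Longrightarrow> f k = 0"
  shows "(\<Sum>k\<le>2 * m. f k) = (\<Sum>j\<le>m. f (2 * j))"
proof -
  have "(\<Sum>k\<le>2 * m. f k) = sum f ((*) 2 ` {..m})"
  proof (intro sum.mono_neutral_right ballI)
    fix k assume k: "k \<in> {..2 * m} - (*) 2 ` {..m}"
    have "odd k"
    proof
      assume "even k"
      then obtain j where "k = 2 * j" by (elim evenE)
      with k show False by auto
    qed
    then show "f k = 0" by (rule assms)
  qed auto
  also have "\<dots> = (\<Sum>j\<le>m. f (2 * j))"
    by (subst sum.reindex) (auto simp: inj_on_def)
  finally show ?thesis .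
qed

lemma moment_ratio_nonneg: "0 \<le> moment_ratio M X k"
  by (simp add: moment_ratio_def)

lemma (in prob_space) moment_ratio_0 [simp]: "moment_ratio M X 0 = 1"
  by (simp add: moment_ratio_def prob_space)

lemma moment_ratio_1: "moment_ratio M X 1 = (\<integral>\<omega>. X \<omega> ^ 2 \<partial>M) / 2"
  by (simp add: moment_ratio_def)

lemma integral_even_power_eq_moment_ratio:
  "(\<integral>\<omega>. X \<omega> ^ (2 * m) \<partial>M) = fact (2 * m) / fact m * moment_ratio M X m"
  by (simp add: moment_ratio_def)

lemma moment_ratio_scale: "moment_ratio M (\<lambda>\<omega>. a * X \<omega>) k = (a\<^sup>2) ^ k * moment_ratio M X k"
  by (simp add: moment_ratio_def power_mult_distrib power_mult)

lemma (in prob_space) indep_var_powers: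
  fixes S Y :: "'a \<Rightarrow> real"
  assumes indep: "indep_var borel Y borel S"
    and "\<And>k. integrable M (\<lambda>\<omega>. S \<omega> ^ k)" "\<And>k. integrable M (\<lambda>\<omega>. Y \<omega> ^ k)"
  shows "(\<integral>\<omega>. S \<omega> ^ i * Y \<omega> ^ j \<partial>M) = (\<integral>\<omega>. S \<omega> ^ i \<partial>M) * (\<integral>\<omega>. Y \<omega> ^ j \<partial>M)"
    and "integrable M (\<lambda>\<omega>. S \<omega> ^ i * Y \<omega> ^ j)"
proof -
  have "indep_var borel ((\<lambda>x. x ^ j) \<circ> Y) borel ((\<lambda>x. x ^ i) \<circ> S)"
    by (intro indep_var_compose[OF indep]) simp_all
  then have "indep_var borel (\<lambda>\<omega>. Y \<omega> ^ j) borel (\<lambda>\<omega>. S \<omega> ^ i)"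
    by (simp add: comp_def)
  from indep_var_lebesgue_integral[OF this] indep_var_integrable[OF this] assms
  show "(\<integral>\<omega>. S \<omega> ^ i * Y \<omega> ^ j \<partial>M) = (\<integral>\<omega>. S \<omega> ^ i \<partial>M) * (\<integral>\<omega>. Y \<omega> ^ j \<partial>M)"
    and "integrable M (\<lambda>\<omega>. S \<omega> ^ i * Y \<omega> ^ j)"
    by (simp_all add: mult.commute)
qed

lemma (in prob_space) integrable_power_add:
  fixes S Y :: "'a \<Rightarrow> real"
  assumes "indep_var borel Y borel S"
    and "\<And>k. integrable M (\<lambda>\<omega>. S \<omega> ^ k)" "\<And>k. integrable M (\<lambda>\<omega>. Y \<omega> ^ k)"
  shows "integrable M (\<lambda>\<omega>. (S \<omega> + Y \<omega>) ^ k)"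
  using indep_var_powers(2)[OF assms] by (simp add: binomial_ring mult.assoc)

text \<open>In each term of the expansion of \<open>E (S + Y)\<^sup>2\<^sup>m\<close> the exponents of \<open>S\<close> and \<open>Y\<close> have the same parity,
  so every term with odd exponents contains an odd moment of \<open>Y\<close> and vanishes.
  In the remaining terms the normalisation turns \<open>(2m choose 2j)\<close> into \<open>(m choose j)\<close>.\<close>

lemma (in prob_space) moment_ratio_add:
  fixes S Y :: "'a \<Rightarrow> real"
  assumes indep: "indep_var borel Y borel S"
    and S: "\<And>k. integrable M (\<lambda>\<omega>. S \<omega> ^ k)" and Y: "\<And>k. integrable M (\<lambda>\<omega>. Y \<omega> ^ k)"
    and odd: "\<And>k. odd k \<Longrightarrow> (\<integral>\<omega>. Y \<omega> ^ k \<partial>M) = 0"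
  shows "moment_ratio M (\<lambda>\<omega>. S \<omega> + Y \<omega>) m = binom_conv (moment_ratio M S) (moment_ratio M Y) m"
proof -
  have "(\<integral>\<omega>. (S \<omega> + Y \<omega>) ^ (2 * m) \<partial>M)
      = (\<Sum>k\<le>2 * m. real ((2 * m) choose k) * ((\<integral>\<omega>. S \<omega> ^ k \<partial>M) * (\<integral>\<omega>. Y \<omega> ^ (2 * m - k) \<partial>M)))"
    using indep_var_powers[OF indep S Y] by (simp add: binomial_ring mult.assoc)
  also have "\<dots> = (\<Sum>k\<le>2 * m. if odd k then 0 else
      real ((2 * m) choose k) * ((\<integral>\<omega>. S \<omega> ^ k \<partial>M) * (\<integral>\<omega>. Y \<omega> ^ (2 * m - k) \<partial>M)))"
    by (intro sum.cong refl) (auto simp: odd)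
  also have "\<dots> = (\<Sum>j\<le>m. real ((2 * m) choose (2 * j)) *
      ((\<integral>\<omega>. S \<omega> ^ (2 * j) \<partial>M) * (\<integral>\<omega>. Y \<omega> ^ (2 * (m - j)) \<partial>M)))"
    by (subst sum_even_indices) (auto simp: right_diff_distrib')
  finally have E: "(\<integral>\<omega>. (S \<omega> + Y \<omega>) ^ (2 * m) \<partial>M) = \<dots>" .
  show ?thesis
    unfolding moment_ratio_def[of _ _ m] binom_conv_def E sum_distrib_left sum_divide_distrib
  proof (intro sum.cong refl)
    fix j assume "j \<in> {..m}"
    then have "j \<le> m" by simp
    then have "real ((2 * m) choose (2 * j)) = fact (2 * m) / (fact (2 * j) * fact (2 * (m - j)))"
      by (simp add: binomial_fact right_diff_distrib')
    moreover have "real (m choose j) = fact m / (fact j * fact (m - j))"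
      using \<open>j \<le> m\<close> by (simp add: binomial_fact)
    ultimately show "fact m * (real ((2 * m) choose (2 * j)) *
        ((\<integral>\<omega>. S \<omega> ^ (2 * j) \<partial>M) * (\<integral>\<omega>. Y \<omega> ^ (2 * (m - j)) \<partial>M))) / fact (2 * m)
      = real (m choose j) * moment_ratio M S j * moment_ratio M Y (m - j)"
      by (simp add: moment_ratio_def)
  qed
qed

lemma symmetric_rv_odd_moment:
  assumes "symmetric_rv M X" "X \<in> borel_measurable M" "odd k"
  shows "(\<integral>\<omega>. X \<omega> ^ k \<partial>M) = 0"
proof -
  have "(\<integral>\<omega>. X \<omega> ^ k \<partial>M) = (\<integral>x. x ^ k \<partial>distr M borel X)"
    using assms by (subst integral_distr) auto
  also have "\<dots> = (\<integral>x. x ^ k \<partial>distr M borel (\<lambda>\<omega>. - X \<omega>))"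
    using assms by (simp add: symmetric_rv_def)
  also have "\<dots> = (\<integral>\<omega>. (- X \<omega>) ^ k \<partial>M)"
    using assms by (subst integral_distr) auto
  also have "\<dots> = - (\<integral>\<omega>. X \<omega> ^ k \<partial>M)"
    using assms by simp
  finally show ?thesis by simp
qed

locale symmetric_moments = prob_space M for M :: "'a measure" +
  fixes X :: "'a \<Rightarrow> real"
  assumes X_measurable [measurable]: "X \<in> borel_measurable M"
    and X_symmetric: "symmetric_rv M X"
    and X_nonzero: "\<not> (AE \<omega> in M. X \<omega> = 0)"
    and X_moments: "integrable M (\<lambda>\<omega>. X \<omega> ^ k)"
begin

abbreviation r :: "nat \<Rightarrow> real" where
  "r \<equiv> moment_ratio M X"

lemma second_moment_pos: "0 < r 1"
proof -
  have "(\<integral>\<omega>. X \<omega> ^ 2 \<partial>M) \<noteq> 0"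
    using X_nonzero integral_nonneg_eq_0_iff_AE[OF X_moments[of 2]] by simp
  moreover have "0 \<le> (\<integral>\<omega>. X \<omega> ^ 2 \<partial>M)"
    by simp
  ultimately have "0 < (\<integral>\<omega>. X \<omega> ^ 2 \<partial>M)"
    by linarith
  then show ?thesis
    unfolding moment_ratio_1 by (rule half_gt_zero)
qed

context
  fixes N :: "'b measure" and n :: nat and Y :: "nat \<Rightarrow> 'b \<Rightarrow> real"
  assumes iid: "iid_copies M X N n Y"
begin

lemma copies_prob_space: "prob_space N"
  using iid by (simp add: iid_copies_def)

lemma copies_measurable:
  assumes "i \<in> {1..n}"
  shows "Y i \<in> borel_measurable N"
proof -
  have "prob_space.indep_vars N (\<lambda>_. borel) Y {1..n}"
    using iid by (simp add: iid_copies_def)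
  then show ?thesis
    using assms unfolding prob_space.indep_vars_def[OF copies_prob_space] by blast
qed

lemma copies_moments:
  assumes i: "i \<in> {1..n}"
  shows "integrable N (\<lambda>\<omega>. Y i \<omega> ^ k)"
    and "(\<integral>\<omega>. Y i \<omega> ^ k \<partial>N) = (\<integral>\<omega>. X \<omega> ^ k \<partial>M)"
proof -
  have distr: "distr N borel (Y i) = distr M borel X"
    using iid i by (simp add: iid_copies_def)
  have "integrable (distr M borel X) (\<lambda>x. x ^ k)"
    by (subst integrable_distr_eq) (simp_all add: X_moments)
  then show "integrable N (\<lambda>\<omega>. Y i \<omega> ^ k)"
    unfolding distr[symmetric] using copies_measurable[OF i] by (subst (asm) integrable_distr_eq) auto
  have "(\<integral>\<omega>. Y i \<omega> ^ k \<partial>N) = (\<integral>x. x ^ k \<partial>distr N borel (Y i))"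
    using copies_measurable[OF i] by (subst integral_distr) auto
  also have "\<dots> = (\<integral>\<omega>. X \<omega> ^ k \<partial>M)"
    unfolding distr by (subst integral_distr) auto
  finally show "(\<integral>\<omega>. Y i \<omega> ^ k \<partial>N) = (\<integral>\<omega>. X \<omega> ^ k \<partial>M)" .
qed

lemma indep_partial_sum:
  assumes "j < n"
  shows "prob_space.indep_var N borel (\<lambda>\<omega>. a (Suc j) * Y (Suc j) \<omega>) borel (weighted_sum j a Y)"
proof -
  interpret N: prob_space N
    by (rule copies_prob_space)
  have "N.indep_vars (\<lambda>_. borel) Y {1..n}"
    using iid by (simp add: iid_copies_def)
  then have "N.indep_vars (\<lambda>_. borel) Y (insert (Suc j) {1..j})"
    by (rule N.indep_vars_subset) (use assms in auto)
  then have "N.indep_vars (\<lambda>_. borel) (\<lambda>i \<omega>. a i * Y i \<omega>) (insert (Suc j) {1..j})"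
    by (rule N.indep_vars_compose2) auto
  from N.indep_vars_sum[OF _ _ this]
  show ?thesis
    by (simp add: weighted_sum_def)
qed

lemma weighted_sum_Suc:
  "weighted_sum (Suc j) a Y = (\<lambda>\<omega>. weighted_sum j a Y \<omega> + a (Suc j) * Y (Suc j) \<omega>)"
  by (simp add: weighted_sum_def)

lemma integrable_weighted_sum_power:
  assumes "j \<le> n"
  shows "integrable N (\<lambda>\<omega>. weighted_sum j a Y \<omega> ^ k)"
  using assms
proof (induction j arbitrary: k)
  case 0
  interpret N: prob_space N
    by (rule copies_prob_space)
  show ?case
    by (simp add: weighted_sum_def)
next
  case (Suc j)
  have "integrable N (\<lambda>\<omega>. (a (Suc j) * Y (Suc j) \<omega>) ^ k)" for k
    using copies_moments(1)[of "Suc j" k] Suc.prems by (simp add: power_mult_distrib)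
  then show ?case
    unfolding weighted_sum_Suc
    using prob_space.integrable_power_add[OF copies_prob_space indep_partial_sum[of j a]] Suc
    by auto
qed

lemma moment_ratio_weighted_sum_0: "moment_ratio N (weighted_sum 0 a Y) k = 0 ^ k"
proof -
  interpret N: prob_space N
    by (rule copies_prob_space)
  show ?thesis
    by (simp add: moment_ratio_def weighted_sum_def N.prob_space power_0_left)
qed

lemma moment_ratio_weighted_sum_Suc:
  assumes "j < n"
  shows "moment_ratio N (weighted_sum (Suc j) a Y) k
    = binom_conv (moment_ratio N (weighted_sum j a Y)) (\<lambda>k. ((a (Suc j))\<^sup>2) ^ k * r k) k"
proof -
  have i: "Suc j \<in> {1..n}"
    using assms by simp
  have "moment_ratio N (\<lambda>\<omega>. a (Suc j) * Y (Suc j) \<omega>) k = ((a (Suc j))\<^sup>2) ^ k * r k" for k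
    unfolding moment_ratio_scale by (simp add: moment_ratio_def copies_moments(2)[OF i])
  then have *: "moment_ratio N (\<lambda>\<omega>. a (Suc j) * Y (Suc j) \<omega>) = (\<lambda>k. ((a (Suc j))\<^sup>2) ^ k * r k)"
    by (rule ext)
  show ?thesis
    unfolding weighted_sum_Suc *[symmetric]
  proof (rule prob_space.moment_ratio_add[OF copies_prob_space indep_partial_sum[OF assms]])
    show "integrable N (\<lambda>\<omega>. (a (Suc j) * Y (Suc j) \<omega>) ^ k)" for k
      using copies_moments(1)[OF i, of k] by (simp add: power_mult_distrib)
    show "(\<integral>\<omega>. (a (Suc j) * Y (Suc j) \<omega>) ^ k \<partial>N) = 0" if "odd k" for k
      using copies_moments(2)[OF i, of k] symmetric_rv_odd_moment[OF X_symmetric X_measurable that]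
      by (simp add: power_mult_distrib)
  qed (use assms integrable_weighted_sum_power in auto)
qed

lemma moment_ratio_weighted_sum_1:
  "moment_ratio N (weighted_sum n a Y) 1 = r 1 * (\<Sum>i=1..n. (a i)\<^sup>2)"
proof -
  interpret N: prob_space N
    by (rule copies_prob_space)
  have "j \<le> n \<Longrightarrow> moment_ratio N (weighted_sum j a Y) 1 = r 1 * (\<Sum>i=1..j. (a i)\<^sup>2)" for j
  proof (induction j)
    case 0
    show ?case
      by (simp add: moment_ratio_weighted_sum_0[simplified])
  next
    case (Suc j)
    then show ?case
      unfolding moment_ratio_weighted_sum_Suc[OF Suc_le_lessD[OF Suc.prems]]
      by (simp add: binom_conv_def algebra_simps)
  qed
  then show ?thesis by simp
qed

text \<open>The sum of squares plays the role of the variance: it adds up along the summands, and the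
  inequality \<open>G\<^sub>s * G\<^sub>t \<le> G\<^sub>s\<^sub>+\<^sub>t\<close> lets \<open>G\<close> absorb one summand after the other.\<close>

lemma moment_ratio_weighted_sum_le:
  fixes G :: "real \<Rightarrow> nat \<Rightarrow> real"
  assumes "\<And>k. k \<le> m \<Longrightarrow> 0 ^ k \<le> G 0 k"
    and le: "\<And>i k. i \<in> {1..n} \<Longrightarrow> k \<le> m \<Longrightarrow> ((a i)\<^sup>2) ^ k * r k \<le> G ((a i)\<^sup>2) k"
    and conv: "\<And>s t k. k \<le> m \<Longrightarrow> 0 \<le> s \<Longrightarrow> 0 \<le> t \<Longrightarrow> binom_conv (G s) (G t) k \<le> G (s + t) k"
  shows "moment_ratio N (weighted_sum n a Y) m \<le> G (\<Sum>i=1..n. (a i)\<^sup>2) m"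
proof (rule binom_conv_comparison[where L = n and m = m and n = n and k = m
    and f = "\<lambda>j. moment_ratio N (weighted_sum j a Y)" and g = "\<lambda>j. G (\<Sum>i=1..j. (a i)\<^sup>2)"
    and \<phi> = "\<lambda>j k. ((a (Suc j))\<^sup>2) ^ k * r k" and \<psi> = "\<lambda>j. G ((a (Suc j))\<^sup>2)"])
  show "binom_conv (G (\<Sum>i=1..j. (a i)\<^sup>2)) (G ((a (Suc j))\<^sup>2)) k \<le> G (\<Sum>i=1..Suc j. (a i)\<^sup>2) k"
    if "k \<le> m" for j k
    using conv[OF that, of "\<Sum>i=1..j. (a i)\<^sup>2" "(a (Suc j))\<^sup>2"] by (simp add: sum_nonneg)
qed (use assms in \<open>auto simp: moment_ratio_nonneg moment_ratio_weighted_sum_Suc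
      moment_ratio_weighted_sum_0 intro!: le\<close>)

text \<open>In the reverse direction \<open>G\<close> is the smaller side of the comparison, so it has to be nonnegative.
  This is required only at the parameters that occur, since falling factorials have negative values
  elsewhere.\<close>

lemma moment_ratio_weighted_sum_ge:
  fixes G :: "real \<Rightarrow> nat \<Rightarrow> real"
  assumes "\<And>k. k \<le> m \<Longrightarrow> G 0 k \<le> 0 ^ k"
    and ge: "\<And>i k. i \<in> {1..n} \<Longrightarrow> k \<le> m \<Longrightarrow> G ((a i)\<^sup>2) k \<le> ((a i)\<^sup>2) ^ k * r k"
    and conv: "\<And>s t k. k \<le> m \<Longrightarrow> 0 \<le> s \<Longrightarrow> 0 \<le> t \<Longrightarrow> G (s + t) k \<le> binom_conv (G s) (G t) k"
    and nonneg: "\<And>i k. i \<in> {1..n} \<Longrightarrow> k \<le> m \<Longrightarrow> 0 \<le> G ((a i)\<^sup>2) k"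
      "\<And>j k. j \<le> n \<Longrightarrow> k \<le> m \<Longrightarrow> 0 \<le> G (\<Sum>i=1..j. (a i)\<^sup>2) k"
  shows "G (\<Sum>i=1..n. (a i)\<^sup>2) m \<le> moment_ratio N (weighted_sum n a Y) m"
proof (rule binom_conv_comparison[where L = n and m = m and n = n and k = m
    and g = "\<lambda>j. moment_ratio N (weighted_sum j a Y)" and f = "\<lambda>j. G (\<Sum>i=1..j. (a i)\<^sup>2)"
    and \<psi> = "\<lambda>j k. ((a (Suc j))\<^sup>2) ^ k * r k" and \<phi> = "\<lambda>j. G ((a (Suc j))\<^sup>2)"])
  show "G (\<Sum>i=1..Suc j. (a i)\<^sup>2) k \<le> binom_conv (G (\<Sum>i=1..j. (a i)\<^sup>2)) (G ((a (Suc j))\<^sup>2)) k"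
    if "k \<le> m" for j k
    using conv[OF that, of "\<Sum>i=1..j. (a i)\<^sup>2" "(a (Suc j))\<^sup>2"] by (simp add: sum_nonneg)
qed (use assms in \<open>auto simp: moment_ratio_weighted_sum_Suc
      moment_ratio_weighted_sum_0 intro!: ge nonneg\<close>)

lemma moment_ratio_weighted_sum_submultiplicative:
  assumes sub: "\<And>i j. r (i + j) \<le> r i * r j"
  shows "r m * (\<Sum>i=1..n. (a i)\<^sup>2) ^ m \<le> moment_ratio N (weighted_sum n a Y) m"
    and "moment_ratio N (weighted_sum n a Y) m \<le> (r 1 * (\<Sum>i=1..n. (a i)\<^sup>2)) ^ m"
proof -
  show "r m * (\<Sum>i=1..n. (a i)\<^sup>2) ^ m \<le> moment_ratio N (weighted_sum n a Y) m"
  proof (rule moment_ratio_weighted_sum_ge[where G = "\<lambda>t k. r k * t ^ k"])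
    show "r k * 0 ^ k \<le> 0 ^ k" for k
      by (simp add: power_0_left)
    show "r k * (s + t) ^ k \<le> binom_conv (\<lambda>k. r k * s ^ k) (\<lambda>k. r k * t ^ k) k"
      if "0 \<le> s" "0 \<le> t" for s t k
      using that sub by (intro binom_conv_weighted_power_ge) auto
  qed (auto simp: mult_ac moment_ratio_nonneg sum_nonneg)
  show "moment_ratio N (weighted_sum n a Y) m \<le> (r 1 * (\<Sum>i=1..n. (a i)\<^sup>2)) ^ m"
  proof (rule moment_ratio_weighted_sum_le[where G = "\<lambda>t k. (r 1 * t) ^ k"])
    show "((a i)\<^sup>2) ^ k * r k \<le> (r 1 * (a i)\<^sup>2) ^ k" for i k
      using submultiplicative_le_power[of r, OF sub] second_moment_pos
      by (simp add: power_mult_distrib mult.commute[of _ "r k"] mult_right_mono)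
  qed (auto simp: binom_conv_power distrib_left)
qed

lemma moment_ratio_weighted_sum_supermultiplicative:
  assumes sup: "\<And>i j. r i * r j \<le> r (i + j)"
  shows "(r 1 * (\<Sum>i=1..n. (a i)\<^sup>2)) ^ m \<le> moment_ratio N (weighted_sum n a Y) m"
    and "moment_ratio N (weighted_sum n a Y) m \<le> r m * (\<Sum>i=1..n. (a i)\<^sup>2) ^ m"
proof -
  show "(r 1 * (\<Sum>i=1..n. (a i)\<^sup>2)) ^ m \<le> moment_ratio N (weighted_sum n a Y) m"
  proof (rule moment_ratio_weighted_sum_ge[where G = "\<lambda>t k. (r 1 * t) ^ k"])
    show "(r 1 * (a i)\<^sup>2) ^ k \<le> ((a i)\<^sup>2) ^ k * r k" for i k
      using supermultiplicative_ge_power[of r, OF sup] second_moment_pos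
      by (simp add: power_mult_distrib mult.commute[of _ "r k"] mult_right_mono)
  qed (use second_moment_pos in \<open>auto simp: binom_conv_power distrib_left sum_nonneg\<close>)
  show "moment_ratio N (weighted_sum n a Y) m \<le> r m * (\<Sum>i=1..n. (a i)\<^sup>2) ^ m"
  proof (rule moment_ratio_weighted_sum_le[where G = "\<lambda>t k. r k * t ^ k"])
    show "0 ^ k \<le> r k * 0 ^ k" for k
      by (simp add: power_0_left)
    show "binom_conv (\<lambda>k. r k * s ^ k) (\<lambda>k. r k * t ^ k) k \<le> r k * (s + t) ^ k"
      if "0 \<le> s" "0 \<le> t" for s t k
      using that sup by (intro binom_conv_weighted_power_le) auto
  qed (auto simp: mult_ac)
qed

text \<open>For unit coefficients all partial sums of squares are natural numbers, so falling factorials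
  with step \<open>r 1\<close> are admissible as lower bounds.\<close>

lemma moment_ratio_sum_between_stepped_factorials:
  assumes "0 \<le> c" "\<And>k. k \<le> m \<Longrightarrow> stepped_factorial (- r 1) (r 1) k \<le> r k"
    and "\<And>k. k \<le> m \<Longrightarrow> r k \<le> stepped_factorial c (r 1) k"
  shows "stepped_factorial (- r 1) (real n * r 1) m \<le> moment_ratio N (weighted_sum n (\<lambda>_. 1) Y) m"
    and "moment_ratio N (weighted_sum n (\<lambda>_. 1) Y) m \<le> stepped_factorial c (real n * r 1) m"
proof -
  have "stepped_factorial (- r 1) ((\<Sum>i=1..n. 1\<^sup>2) * r 1) m
      \<le> moment_ratio N (weighted_sum n (\<lambda>_. 1) Y) m"
  proof (rule moment_ratio_weighted_sum_ge[where G = "\<lambda>t k. stepped_factorial (- r 1) (t * r 1) k"])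
    show "0 \<le> stepped_factorial (- r 1) (1\<^sup>2 * r 1) k" for k
      using falling_stepped_factorial_nonneg[of "r 1" 1 k] second_moment_pos by simp
    show "0 \<le> stepped_factorial (- r 1) ((\<Sum>i=1..j. 1\<^sup>2) * r 1) k" for j :: nat and k
      using falling_stepped_factorial_nonneg[of "r 1" j k] second_moment_pos by simp
  qed (use assms in \<open>auto simp: stepped_factorial_0_left stepped_factorial_add distrib_right\<close>)
  then show "stepped_factorial (- r 1) (real n * r 1) m
      \<le> moment_ratio N (weighted_sum n (\<lambda>_. 1) Y) m"
    by simp
  have "moment_ratio N (weighted_sum n (\<lambda>_. 1) Y) m \<le> stepped_factorial c ((\<Sum>i=1..n. 1\<^sup>2) * r 1) m"
    by (rule moment_ratio_weighted_sum_le[where G = "\<lambda>t k. stepped_factorial c (t * r 1) k"])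
      (use assms in \<open>auto simp: stepped_factorial_0_left stepped_factorial_add distrib_right\<close>)
  then show "moment_ratio N (weighted_sum n (\<lambda>_. 1) Y) m \<le> stepped_factorial c (real n * r 1) m"
    by simp
qed

end

end

section \<open>Norms of even order\<close>

lemma Lp_norm_even:
  assumes "p = 2 * m" "0 < m"
  shows "Lp_norm N (real p) S = (fact p / fact m * moment_ratio N S m) powr (1 / real p)"
proof -
  have "even p" "p \<noteq> 0"
    using assms by auto
  then have "\<bar>x\<bar> powr real p = x ^ p" for x :: real
    by (simp add: powr_realpow' power_even_abs)
  then show ?thesis
    using integral_even_power_eq_moment_ratio[of N S m] assms by (simp add: Lp_norm_def)
qed

text \<open>The exponent \<open>1 / p\<close> matches the one in \<open>Lp_norm_even\<close>, so that comparisons of norms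
  become comparisons of moment ratios.\<close>

lemma Lp_norm_2_eq_powr:
  assumes "p = 2 * m" "0 < m"
  shows "Lp_norm N 2 S = ((2 * moment_ratio N S 1) ^ m) powr (1 / real p)"
proof -
  have "((2 * moment_ratio N S 1) ^ m) powr (1 / real p)
      = ((2 * moment_ratio N S 1) powr real m) powr (1 / real p)"
    using assms by (simp add: powr_realpow' moment_ratio_nonneg)
  also have "\<dots> = (2 * moment_ratio N S 1) powr (1 / 2)"
    using assms by (simp add: powr_powr)
  finally show ?thesis
    using Lp_norm_even[of 2 1 N S] by simp
qed

lemma Lp_norm_quotient:
  assumes "p = 2 * m" "0 < m"
  shows "Lp_norm N (real p) S / Lp_norm N 2 S
    = (fact p / fact m * (moment_ratio N S m / (2 * moment_ratio N S 1) ^ m)) powr (1 / real p)"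
  unfolding Lp_norm_even[OF assms] Lp_norm_2_eq_powr[OF assms]
  by (subst powr_divide[symmetric]) (auto simp: moment_ratio_nonneg)

text \<open>A standard Gaussian variable has the moment ratios \<open>1 / 2 ^ m\<close>.\<close>

lemma gaussian_norm_even:
  assumes "p = 2 * m" "0 < m"
  shows "gaussian_norm (real p) = (fact p / fact m * (1 / 2 ^ m)) powr (1 / real p)"
proof -
  have "(\<integral>x. x ^ (2 * m) \<partial>density lborel std_normal_density) = fact (2 * m) / (2 ^ m * fact m)"
    by (subst integral_density) (auto simp: integral_std_normal_moment_even)
  then have "moment_ratio (density lborel std_normal_density) (\<lambda>x. x) m = 1 / 2 ^ m"
    by (simp add: moment_ratio_def)
  then show ?thesis
    by (simp add: gaussian_norm_def Lp_norm_even[OF assms])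
qed

lemma Lp_norm_ge:
  assumes "p = 2 * m" "0 < m" "0 \<le> c"
    and "c * (2 * moment_ratio N S 1) ^ m \<le> moment_ratio N S m"
  shows "(fact p / fact m * c) powr (1 / real p) * Lp_norm N 2 S \<le> Lp_norm N (real p) S"
proof -
  have "(fact p / fact m * c) powr (1 / real p) * Lp_norm N 2 S
      = (fact p / fact m * (c * (2 * moment_ratio N S 1) ^ m)) powr (1 / real p)"
    using assms by (simp add: Lp_norm_2_eq_powr[OF assms(1,2)] powr_mult[symmetric] mult.assoc
        moment_ratio_nonneg)
  also have "\<dots> \<le> Lp_norm N (real p) S"
    unfolding Lp_norm_even[OF assms(1,2)] using assms
    by (intro powr_mono2 mult_left_mono) (auto simp: moment_ratio_nonneg)
  finally show ?thesis .
qed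

lemma Lp_norm_le:
  assumes "p = 2 * m" "0 < m" "0 \<le> c"
    and "moment_ratio N S m \<le> c * (2 * moment_ratio N S 1) ^ m"
  shows "Lp_norm N (real p) S \<le> (fact p / fact m * c) powr (1 / real p) * Lp_norm N 2 S"
proof -
  have "Lp_norm N (real p) S
      \<le> (fact p / fact m * (c * (2 * moment_ratio N S 1) ^ m)) powr (1 / real p)"
    unfolding Lp_norm_even[OF assms(1,2)] using assms
    by (intro powr_mono2 mult_left_mono) (auto simp: moment_ratio_nonneg)
  also have "\<dots> = (fact p / fact m * c) powr (1 / real p) * Lp_norm N 2 S"
    using assms by (simp add: Lp_norm_2_eq_powr[OF assms(1,2)] powr_mult[symmetric] mult.assoc
        moment_ratio_nonneg)
  finally show ?thesis .
qed

section \<open>Optimality of the constants\<close>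

definition canonical_space :: "'a measure \<Rightarrow> ('a \<Rightarrow> real) \<Rightarrow> nat \<Rightarrow> (nat \<Rightarrow> real) measure" where
  "canonical_space M X n = (\<Pi>\<^sub>M i\<in>{1..n}. distr M borel X)"

lemma (in prob_space) iid_copies_canonical:
  assumes X: "X \<in> borel_measurable M" and n: "1 \<le> n"
  shows "iid_copies M X (canonical_space M X n) n (\<lambda>i \<omega>. \<omega> i)"
proof -
  let ?D = "distr M borel X" and ?N = "canonical_space M X n"
  have D: "prob_space ?D"
    by (rule prob_space_distr[OF X])
  interpret N: prob_space ?N
    unfolding canonical_space_def by (intro prob_space_PiM D)
  have coordinate: "distr ?N borel (\<lambda>\<omega>. \<omega> i) = ?D" if "i \<in> {1..n}" for i
  proof -
    have "distr ?N borel (\<lambda>\<omega>. \<omega> i) = distr ?N ?D (\<lambda>\<omega>. \<omega> i)"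
      by (intro distr_cong) auto
    also have "\<dots> = ?D"
      unfolding canonical_space_def using that by (intro distr_PiM_component D)
    finally show ?thesis .
  qed
  have sets: "sets ?N = sets (\<Pi>\<^sub>M i\<in>{1..n}. borel)"
    unfolding canonical_space_def by (intro sets_PiM_cong) auto
  have "N.indep_vars (\<lambda>_. borel) (\<lambda>i \<omega>. \<omega> i) {1..n}"
  proof (subst N.indep_vars_iff_distr_eq_PiM')
    have "distr ?N (\<Pi>\<^sub>M i\<in>{1..n}. borel) (\<lambda>x. \<lambda>i\<in>{1..n}. x i) = distr ?N ?N (\<lambda>x. x)"
      by (rule distr_cong[OF refl sets[symmetric]])
        (auto simp: canonical_space_def space_PiM PiE_restrict)
    also have "\<dots> = (\<Pi>\<^sub>M i\<in>{1..n}. distr ?N borel (\<lambda>x. x i))"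
      unfolding distr_id by (subst canonical_space_def) (intro PiM_cong refl, simp add: coordinate)
    finally show "distr ?N (\<Pi>\<^sub>M i\<in>{1..n}. borel) (\<lambda>x. \<lambda>i\<in>{1..n}. x i)
      = (\<Pi>\<^sub>M i\<in>{1..n}. distr ?N borel (\<lambda>x. x i))" .
  qed (use n sets in \<open>auto intro: measurable_component_singleton cong: measurable_cong_sets\<close>)
  then show ?thesis
    using N.prob_space_axioms coordinate by (simp add: iid_copies_def)
qed

context symmetric_moments
begin

lemma canonical_moment_ratio_asymp:
  "(\<lambda>n. moment_ratio (canonical_space M X n) (weighted_sum n (\<lambda>_. 1) (\<lambda>i \<omega>. \<omega> i)) m / real n ^ m)
    \<longlonglongrightarrow> r 1 ^ m"
proof -
  obtain c where c: "0 \<le> c" "\<And>k. k \<le> m \<Longrightarrow> stepped_factorial (- r 1) (r 1) k \<le> r k"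
      "\<And>k. k \<le> m \<Longrightarrow> r k \<le> stepped_factorial c (r 1) k"
    by (rule sequence_between_stepped_factorials[of r m])
      (use second_moment_pos moment_ratio_nonneg in auto)
  show ?thesis
  proof (rule tendsto_sandwich[OF _ _ stepped_factorial_asymp[of "- r 1"] stepped_factorial_asymp[of c]])
    show "\<forall>\<^sub>F n in sequentially. stepped_factorial (- r 1) (real n * r 1) m / real n ^ m
      \<le> moment_ratio (canonical_space M X n) (weighted_sum n (\<lambda>_. 1) (\<lambda>i \<omega>. \<omega> i)) m / real n ^ m"
      using eventually_ge_at_top[of 1]
      by eventually_elim (intro divide_right_mono zero_le_power of_nat_0_le_iff
          moment_ratio_sum_between_stepped_factorials(1)[OF iid_copies_canonical c] X_measurable)
    show "\<forall>\<^sub>F n in sequentially.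
      moment_ratio (canonical_space M X n) (weighted_sum n (\<lambda>_. 1) (\<lambda>i \<omega>. \<omega> i)) m / real n ^ m
        \<le> stepped_factorial c (real n * r 1) m / real n ^ m"
      using eventually_ge_at_top[of 1]
      by eventually_elim (intro divide_right_mono zero_le_power of_nat_0_le_iff
          moment_ratio_sum_between_stepped_factorials(2)[OF iid_copies_canonical c] X_measurable)
  qed
qed

text \<open>For even \<open>p\<close> this is the convergence of moments in the central limit theorem.\<close>

lemma canonical_norm_quotient_tendsto:
  assumes "p = 2 * m" "0 < m"
  shows "(\<lambda>n. Lp_norm (canonical_space M X n) (real p) (weighted_sum n (\<lambda>_. 1) (\<lambda>i \<omega>. \<omega> i))
      / Lp_norm (canonical_space M X n) 2 (weighted_sum n (\<lambda>_. 1) (\<lambda>i \<omega>. \<omega> i)))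
    \<longlonglongrightarrow> gaussian_norm (real p)"
proof -
  let ?s = "\<lambda>n. moment_ratio (canonical_space M X n) (weighted_sum n (\<lambda>_. 1) (\<lambda>i \<omega>. \<omega> i))"
  have "(\<lambda>n. (fact p / fact m * (?s n m / real n ^ m / (2 * r 1) ^ m)) powr (1 / real p))
      \<longlonglongrightarrow> (fact p / fact m * (r 1 ^ m / (2 * r 1) ^ m)) powr (1 / real p)"
    using second_moment_pos
    by (intro tendsto_powr tendsto_mult tendsto_divide tendsto_const canonical_moment_ratio_asymp) auto
  moreover have "r 1 ^ m / (2 * r 1) ^ m = 1 / 2 ^ m"
    using second_moment_pos by (simp add: power_mult_distrib)
  moreover have "\<forall>\<^sub>F n in sequentially.
      (fact p / fact m * (?s n m / real n ^ m / (2 * r 1) ^ m)) powr (1 / real p)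
      = Lp_norm (canonical_space M X n) (real p) (weighted_sum n (\<lambda>_. 1) (\<lambda>i \<omega>. \<omega> i))
      / Lp_norm (canonical_space M X n) 2 (weighted_sum n (\<lambda>_. 1) (\<lambda>i \<omega>. \<omega> i))"
    using eventually_ge_at_top[of 1]
  proof eventually_elim
    case (elim n)
    have "?s n 1 = r 1 * real n"
      by (subst moment_ratio_weighted_sum_1[OF iid_copies_canonical[OF X_measurable elim]]) simp
    then show ?case
      unfolding Lp_norm_quotient[OF assms] by (simp add: power_mult_distrib mult_ac)
  qed
  ultimately show ?thesis
    using gaussian_norm_even[OF assms] by (simp add: tendsto_cong mult.commute)
qed

lemma canonical_Lp_norm_2_pos:
  assumes "1 \<le> n"
  shows "0 < Lp_norm (canonical_space M X n) 2 (weighted_sum n (\<lambda>_. 1) (\<lambda>i \<omega>. \<omega> i))"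
proof -
  have "moment_ratio (canonical_space M X n) (weighted_sum n (\<lambda>_. 1) (\<lambda>i \<omega>. \<omega> i)) 1 = r 1 * real n"
    by (subst moment_ratio_weighted_sum_1[OF iid_copies_canonical[OF X_measurable assms]]) simp
  then show ?thesis
    using Lp_norm_2_eq_powr[of 2 1 "canonical_space M X n" "weighted_sum n (\<lambda>_. 1) (\<lambda>i \<omega>. \<omega> i)"]
      second_moment_pos assms by simp
qed

lemma canonical_norm_quotient_single:
  assumes "p = 2 * m" "0 < m"
  shows "Lp_norm (canonical_space M X 1) (real p) (weighted_sum 1 (\<lambda>_. 1) (\<lambda>i \<omega>. \<omega> i))
      / Lp_norm (canonical_space M X 1) 2 (weighted_sum 1 (\<lambda>_. 1) (\<lambda>i \<omega>. \<omega> i))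
    = Lp_norm M (real p) X / Lp_norm M 2 X"
proof -
  have "moment_ratio (canonical_space M X 1) (weighted_sum 1 (\<lambda>_. 1) (\<lambda>i \<omega>. \<omega> i)) k = r k" for k
    using copies_moments(2)[OF iid_copies_canonical[OF X_measurable order_refl], of 1 "2 * k"]
    by (simp add: moment_ratio_def weighted_sum_def)
  then show ?thesis
    unfolding Lp_norm_quotient[OF assms] by simp
qed

lemma lower_comparison_canonical:
  assumes "lower_comparison TYPE(nat \<Rightarrow> real) M X p C" "1 \<le> n"
  shows "C \<le> Lp_norm (canonical_space M X n) p (weighted_sum n (\<lambda>_. 1) (\<lambda>i \<omega>. \<omega> i))
    / Lp_norm (canonical_space M X n) 2 (weighted_sum n (\<lambda>_. 1) (\<lambda>i \<omega>. \<omega> i))"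
  using assms canonical_Lp_norm_2_pos[OF assms(2)] iid_copies_canonical[OF X_measurable assms(2)]
  by (simp add: lower_comparison_def pos_le_divide_eq)

lemma upper_comparison_canonical:
  assumes "upper_comparison TYPE(nat \<Rightarrow> real) M X p C" "1 \<le> n"
  shows "Lp_norm (canonical_space M X n) p (weighted_sum n (\<lambda>_. 1) (\<lambda>i \<omega>. \<omega> i))
    / Lp_norm (canonical_space M X n) 2 (weighted_sum n (\<lambda>_. 1) (\<lambda>i \<omega>. \<omega> i)) \<le> C"
  using assms canonical_Lp_norm_2_pos[OF assms(2)] iid_copies_canonical[OF X_measurable assms(2)]
  by (simp add: upper_comparison_def pos_divide_le_eq)

lemma lower_comparison_optimal:
  assumes "p = 2 * m" "0 < m" "lower_comparison TYPE(nat \<Rightarrow> real) M X (real p) C"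
  shows "C \<le> Lp_norm M (real p) X / Lp_norm M 2 X" and "C \<le> gaussian_norm (real p)"
proof -
  show "C \<le> Lp_norm M (real p) X / Lp_norm M 2 X"
    using lower_comparison_canonical[OF assms(3), of 1] canonical_norm_quotient_single[OF assms(1,2)]
    by simp
  show "C \<le> gaussian_norm (real p)"
    using lower_comparison_canonical[OF assms(3)]
    by (intro LIMSEQ_le_const[OF canonical_norm_quotient_tendsto[OF assms(1,2)]]) blast
qed

lemma upper_comparison_optimal:
  assumes "p = 2 * m" "0 < m" "upper_comparison TYPE(nat \<Rightarrow> real) M X (real p) C"
  shows "Lp_norm M (real p) X / Lp_norm M 2 X \<le> C" and "gaussian_norm (real p) \<le> C"
proof -
  show "Lp_norm M (real p) X / Lp_norm M 2 X \<le> C"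
    using upper_comparison_canonical[OF assms(3), of 1] canonical_norm_quotient_single[OF assms(1,2)]
    by simp
  show "gaussian_norm (real p) \<le> C"
    using upper_comparison_canonical[OF assms(3)]
    by (intro LIMSEQ_le_const2[OF canonical_norm_quotient_tendsto[OF assms(1,2)]]) blast
qed

section \<open>The comparison of moments\<close>

lemma submultiplicative_comparison:
  assumes p: "p = 2 * m" "0 < m" and sub: "\<And>i j. r (i + j) \<le> r i * r j"
  shows "lower_comparison TYPE('b) M X (real p) (Lp_norm M (real p) X / Lp_norm M 2 X)"
    and "upper_comparison TYPE('b) M X (real p) (gaussian_norm (real p))"
proof -
  show "lower_comparison TYPE('b) M X (real p) (Lp_norm M (real p) X / Lp_norm M 2 X)"
    unfolding lower_comparison_def Lp_norm_quotient[OF p, of M X]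
  proof (intro allI impI Lp_norm_ge p)
    fix n a and N :: "'b measure" and Y assume iid: "iid_copies M X N n Y"
    \<comment> \<open>The left-hand side equals \<open>r m * (\<Sum>i=1..n. (a i)\<^sup>2) ^ m\<close>.\<close>
    show "r m / (2 * r 1) ^ m * (2 * moment_ratio N (weighted_sum n a Y) 1) ^ m
        \<le> moment_ratio N (weighted_sum n a Y) m"
      using moment_ratio_weighted_sum_submultiplicative(1)[OF iid sub, where m = m and a = a] second_moment_pos
      unfolding moment_ratio_weighted_sum_1[OF iid] by (simp add: power_mult_distrib)
  qed (simp add: moment_ratio_nonneg)
  show "upper_comparison TYPE('b) M X (real p) (gaussian_norm (real p))"
    unfolding upper_comparison_def gaussian_norm_even[OF p]
  proof (intro allI impI Lp_norm_le p)
    fix n a and N :: "'b measure" and Y assume iid: "iid_copies M X N n Y"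
    show "moment_ratio N (weighted_sum n a Y) m
        \<le> 1 / 2 ^ m * (2 * moment_ratio N (weighted_sum n a Y) 1) ^ m"
      using moment_ratio_weighted_sum_submultiplicative(2)[OF iid sub, where m = m and a = a]
      unfolding moment_ratio_weighted_sum_1[OF iid] by (simp add: power_mult_distrib)
  qed simp
qed

lemma supermultiplicative_comparison:
  assumes p: "p = 2 * m" "0 < m" and sup: "\<And>i j. r i * r j \<le> r (i + j)"
  shows "lower_comparison TYPE('b) M X (real p) (gaussian_norm (real p))"
    and "upper_comparison TYPE('b) M X (real p) (Lp_norm M (real p) X / Lp_norm M 2 X)"
proof -
  show "lower_comparison TYPE('b) M X (real p) (gaussian_norm (real p))"
    unfolding lower_comparison_def gaussian_norm_even[OF p]
  proof (intro allI impI Lp_norm_ge p)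
    fix n a and N :: "'b measure" and Y assume iid: "iid_copies M X N n Y"
    show "1 / 2 ^ m * (2 * moment_ratio N (weighted_sum n a Y) 1) ^ m
        \<le> moment_ratio N (weighted_sum n a Y) m"
      using moment_ratio_weighted_sum_supermultiplicative(1)[OF iid sup, where m = m and a = a]
      unfolding moment_ratio_weighted_sum_1[OF iid] by (simp add: power_mult_distrib)
  qed simp
  show "upper_comparison TYPE('b) M X (real p) (Lp_norm M (real p) X / Lp_norm M 2 X)"
    unfolding upper_comparison_def Lp_norm_quotient[OF p, of M X]
  proof (intro allI impI Lp_norm_le p)
    fix n a and N :: "'b measure" and Y assume iid: "iid_copies M X N n Y"
    show "moment_ratio N (weighted_sum n a Y) m
        \<le> r m / (2 * r 1) ^ m * (2 * moment_ratio N (weighted_sum n a Y) 1) ^ m"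
      using moment_ratio_weighted_sum_supermultiplicative(2)[OF iid sup, where m = m and a = a] second_moment_pos
      unfolding moment_ratio_weighted_sum_1[OF iid] by (simp add: power_mult_distrib)
  qed (simp add: moment_ratio_nonneg)
qed

end

theorem theorem1p5:
  fixes M :: "'a measure" and X :: "'a \<Rightarrow> real" and p :: nat
  assumes "prob_space M"
    and "X \<in> borel_measurable M"
    and "symmetric_rv M X"
    and "\<not> (AE \<omega> in M. X \<omega> = 0)"
    and "\<And>k :: nat. integrable M (\<lambda>\<omega>. X \<omega> ^ k)"
    and "p \<ge> 2" and "even p"
  shows
    "(log_concave_seq (moment_ratio M X) \<longrightarrow>
        lower_comparison TYPE('b) M X p (Lp_norm M p X / Lp_norm M 2 X) \<and>
        upper_comparison TYPE('b) M X p (gaussian_norm p) \<and>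
        (\<forall>C. lower_comparison TYPE(nat \<Rightarrow> real) M X p C \<longrightarrow> C \<le> Lp_norm M p X / Lp_norm M 2 X) \<and>
        (\<forall>C. upper_comparison TYPE(nat \<Rightarrow> real) M X p C \<longrightarrow> gaussian_norm p \<le> C)) \<and>
     (log_convex_seq (moment_ratio M X) \<longrightarrow>
        lower_comparison TYPE('b) M X p (gaussian_norm p) \<and>
        upper_comparison TYPE('b) M X p (Lp_norm M p X / Lp_norm M 2 X) \<and>
        (\<forall>C. lower_comparison TYPE(nat \<Rightarrow> real) M X p C \<longrightarrow> C \<le> gaussian_norm p) \<and>
        (\<forall>C. upper_comparison TYPE(nat \<Rightarrow> real) M X p C \<longrightarrow> Lp_norm M p X / Lp_norm M 2 X \<le> C))"
proof -
  interpret symmetric_moments M X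
    using assms by (intro symmetric_moments.intro symmetric_moments_axioms.intro)
  obtain m where m: "p = 2 * m"
    using \<open>even p\<close> by (elim evenE)
  then have "0 < m"
    using \<open>p \<ge> 2\<close> by simp
  note p = m this
  show ?thesis
  proof (intro conjI impI allI)
    assume r: "log_concave_seq r"
    note sub = log_concave_submultiplicative[OF r moment_ratio_0]
    show "lower_comparison TYPE('b) M X p (Lp_norm M p X / Lp_norm M 2 X)"
      by (rule submultiplicative_comparison(1)[OF p sub])
    show "upper_comparison TYPE('b) M X p (gaussian_norm p)"
      by (rule submultiplicative_comparison(2)[OF p sub])
  next
    assume r: "log_convex_seq r"
    note sup = log_convex_supermultiplicative[OF r moment_ratio_0]
    show "lower_comparison TYPE('b) M X p (gaussian_norm p)"
      by (rule supermultiplicative_comparison(1)[OF p sup])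
    show "upper_comparison TYPE('b) M X p (Lp_norm M p X / Lp_norm M 2 X)"
      by (rule supermultiplicative_comparison(2)[OF p sup])
  qed (rule lower_comparison_optimal[OF p] upper_comparison_optimal[OF p], assumption)+
qed

end
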